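(* Let $(J,\circ)$ be a $2$-dimensional Jordan algebra over $\mathbb{C}$, let $R:J\to J$ be a Rota-Baxter operator (of weight $0$) on $(J,\circ)$, and let $(J,\cdot)$ be the induced pre-Jordan algebra, $x\cdot y:=R(x)\circ y$. Then $(J,\cdot)$ is isomorphic to one of the following pre-Jordan algebras, given by their formal characteristic matrices with respect to a basis $\{e_1,e_2\}$: $$J_{2,2}:\begin{pmatrix} e_1&2e_2\\0&0\end{pmatrix},\qquad J_{5,1}:\begin{pmatrix} e_2&0\\0&0\end{pmatrix},\qquad J_{6,1}:\begin{pmatrix} 0&0\\0&0\end{pmatrix}.$$
   Context: All vector spaces and algebras are over $\mathbb{C}$. A Jordan algebra is a vector space $J$ with a commutative bilinear multiplication $\circ$ satisfying $((x\circ x)\circ y)\circ x=(x\circ x)\circ(y\circ x)$ for all $x,y$. A Rota-Baxter operator (of weight $0$) on $(J,\circ)$ is a linear map $R:J\to J$ with $R(x)\circ R(y)=R(R(x)\circ y+x\circ R(y))$ for all $x,y\in J$. A pre-Jordan algebra is a vector space $A$ with a bilinear multiplication $\cdot$ such that, writing $x\circ y:=x\cdot y+y\cdot x$, for all $x,y,z,u$: $$(x\circ y)\cdot(z\cdot u)+(y\circ z)\cdot(x\cdot u)+(z\circ x)\cdot(y\cdot u)= x\cdot(y\cdot(z\cdot u))+z\cdot(y\cdot(x\cdot u))+((x\circ z)\circ y)\cdot u= z\cdot((x\circ y)\cdot u)+x\cdot((y\circ z)\cdot u)+y\cdot((z\circ x)\cdot u).$$ If $R$ is a Rota-Baxter operator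 on $(J,\circ)$, then $x\cdot y:=R(x)\circ y$ is known to define a pre-Jordan algebra on $J$ (whose anticommutator need not be the original $\circ$), called the induced pre-Jordan algebra. Isomorphisms are bijective linear maps preserving multiplication. The formal characteristic matrix of an algebra with basis $\{e_i\}$ has $(i,j)$ entry $e_i\cdot e_j$. *)

theory Defs
  imports "HOL-Analysis.Analysis"
begin

text \<open>Algebras over the complex numbers, not assumed associative, commutative or unital; the
  carrier is the whole type \<^typ>\<open>'a\<close>.\<close>

locale complex_algebra = vector_space scale
  for scale :: "complex \<Rightarrow> 'a::ab_group_add \<Rightarrow> 'a" +
  fixes mult :: "'a \<Rightarrow> 'a \<Rightarrow> 'a"
  assumes linear_mult_left: "Vector_Spaces.linear scale scale (\<lambda>x. mult x y)"
    and linear_mult_right: "Vector_Spaces.linear scale scale (\<lambda>y. mult x y)"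

locale jordan_algebra = complex_algebra scale mult
  for scale :: "complex \<Rightarrow> 'a::ab_group_add \<Rightarrow> 'a" and mult :: "'a \<Rightarrow> 'a \<Rightarrow> 'a" +
  assumes mult_commute: "mult x y = mult y x"
    and jordan_identity: "mult (mult (mult x x) y) x = mult (mult x x) (mult y x)"

locale rota_baxter_operator = jordan_algebra scale mult
  for scale :: "complex \<Rightarrow> 'a::ab_group_add \<Rightarrow> 'a" and mult :: "'a \<Rightarrow> 'a \<Rightarrow> 'a" +
  fixes R :: "'a \<Rightarrow> 'a"
  assumes linear_R: "Vector_Spaces.linear scale scale R"
    and rota_baxter: "mult (R x) (R y) = R (mult (R x) y + mult x (R y))"

definition (in complex_algebra) anticommutator :: "'a \<Rightarrow> 'a \<Rightarrow> 'a" (infixl "\<odot>" 70)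
  where "x \<odot> y = mult x y + mult y x"

locale pre_jordan_algebra = complex_algebra scale mult
  for scale :: "complex \<Rightarrow> 'a::ab_group_add \<Rightarrow> 'a" and mult :: "'a \<Rightarrow> 'a \<Rightarrow> 'a" (infixl "\<cdot>" 70) +
  assumes pre_jordan_1:
      "(x \<odot> y) \<cdot> (z \<cdot> u) + (y \<odot> z) \<cdot> (x \<cdot> u) + (z \<odot> x) \<cdot> (y \<cdot> u)
        = x \<cdot> (y \<cdot> (z \<cdot> u)) + z \<cdot> (y \<cdot> (x \<cdot> u)) + ((x \<odot> z) \<odot> y) \<cdot> u"
    and pre_jordan_2:
      "x \<cdot> (y \<cdot> (z \<cdot> u)) + z \<cdot> (y \<cdot> (x \<cdot> u)) + ((x \<odot> z) \<odot> y) \<cdot> u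
        = z \<cdot> ((x \<odot> y) \<cdot> u) + x \<cdot> ((y \<odot> z) \<cdot> u) + y \<cdot> ((z \<odot> x) \<cdot> u)"

locale pre_jordan_isomorphism =
  A: pre_jordan_algebra scaleA multA + B: pre_jordan_algebra scaleB multB +
  Vector_Spaces.linear scaleA scaleB f
  for scaleA :: "complex \<Rightarrow> 'a::ab_group_add \<Rightarrow> 'a" and multA :: "'a \<Rightarrow> 'a \<Rightarrow> 'a"
    and scaleB :: "complex \<Rightarrow> 'b::ab_group_add \<Rightarrow> 'b" and multB :: "'b \<Rightarrow> 'b \<Rightarrow> 'b"
    and f :: "'a \<Rightarrow> 'b" +
  assumes bij: "bij f"
    and map_mult: "f (multA x y) = multB (f x) (f y)"

definition pre_jordan_isomorphic ::
    "(complex \<Rightarrow> 'a::ab_group_add \<Rightarrow> 'a) \<Rightarrow> ('a \<Rightarrow> 'a \<Rightarrow> 'a) \<Rightarrow>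
     (complex \<Rightarrow> 'b::ab_group_add \<Rightarrow> 'b) \<Rightarrow> ('b \<Rightarrow> 'b \<Rightarrow> 'b) \<Rightarrow> bool"
  where "pre_jordan_isomorphic scaleA multA scaleB multB \<longleftrightarrow>
    (\<exists>f. pre_jordan_isomorphism scaleA multA scaleB multB f)"

definition induced_mult :: "('a \<Rightarrow> 'a \<Rightarrow> 'a) \<Rightarrow> ('a \<Rightarrow> 'a) \<Rightarrow> 'a \<Rightarrow> 'a \<Rightarrow> 'a"
  where "induced_mult circ R x y = circ (R x) y"

text \<open>The product on \<open>\<complex>\<^sup>2\<close> with formal characteristic matrix \<open>M\<close> in the standard basis: the entry
  \<open>M $ i $ j\<close> is itself a vector, the product of the \<open>i\<close>-th and the \<open>j\<close>-th basis vector, and the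
  product is extended bilinearly.\<close>

definition char_matrix_mult :: "complex^2^2^2 \<Rightarrow> complex^2 \<Rightarrow> complex^2 \<Rightarrow> complex^2"
  where "char_matrix_mult M x y = (\<Sum>i\<in>UNIV. \<Sum>j\<in>UNIV. (x $ i * y $ j) *s M $ i $ j)"

definition e1 :: "complex^2" where "e1 = axis 1 1"
definition e2 :: "complex^2" where "e2 = axis 2 1"

definition J22 :: "complex^2^2^2"
  where "J22 = vector [vector [e1, 2 *s e2], vector [0, 0]]"

definition J51 :: "complex^2^2^2"
  where "J51 = vector [vector [e2, 0], vector [0, 0]]"

definition J61 :: "complex^2^2^2"
  where "J61 = vector [vector [0, 0], vector [0, 0]]"


text \<open>The induced product and the three products on the list are pre-Jordan, so requiring this of
  both sides of an isomorphism imposes no extra condition.\<close>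

lemma (in complex_algebra)
  shows add_left: "mult (x + y) z = mult x z + mult y z"
    and add_right: "mult z (x + y) = mult z x + mult z y"
    and scale_left: "mult (scale c x) z = scale c (mult x z)"
    and scale_right: "mult z (scale c x) = scale c (mult z x)"
proof -
  interpret l: Vector_Spaces.linear scale scale "\<lambda>x. mult x z" by (rule linear_mult_left)
  interpret r: Vector_Spaces.linear scale scale "\<lambda>y. mult z y" by (rule linear_mult_right)
  show "mult (x + y) z = mult x z + mult y z" by (rule l.add)
  show "mult z (x + y) = mult z x + mult z y" by (rule r.add)
  show "mult (scale c x) z = scale c (mult x z)" by (rule l.scale)
  show "mult z (scale c x) = scale c (mult z x)" by (rule r.scale)
qed

lemma (in jordan_algebra) jordan_identity_linearized:
  "mult (mult (mult a b) y) c + mult (mult (mult b c) y) a + mult (mult (mult c a) y) b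
    = mult (mult a b) (mult y c) + mult (mult b c) (mult y a) + mult (mult c a) (mult y b)"
  (is "?L = ?R")
proof -
  define D where "D x = mult (mult (mult x x) y) x - mult (mult x x) (mult y x)" for x
  have D0: "D x = 0" for x
    by (simp add: D_def jordan_identity)
  have "(?L - ?R) + (?L - ?R)
      = D (a + b + c) - D (a + b) - D (b + c) - D (c + a) + D a + D b + D c"
    unfolding D_def
    by (simp add: add_left add_right mult_commute[of b a] mult_commute[of c b] mult_commute[of a c]
        algebra_simps)
  hence "scale 2 (?L - ?R) = 0"
    unfolding D0 using scale_left_distrib[of 1 1 "?L - ?R"] by simp
  thus ?thesis by simp
qed

lemma (in rota_baxter_operator) pre_jordan_induced_mult:
  "pre_jordan_algebra scale (induced_mult mult R)"
proof -
  interpret R: Vector_Spaces.linear scale scale R by (rule linear_R)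
  interpret ind: complex_algebra scale "induced_mult mult R"
    by unfold_locales
      (simp_all add: induced_mult_def add_left add_right scale_left scale_right R.add R.scale)
  have R_circ: "R (ind.anticommutator x y) = mult (R x) (R y)" for x y
    by (simp add: ind.anticommutator_def induced_mult_def rota_baxter mult_commute[of "R y" x])
  show ?thesis
  proof unfold_locales
    fix x y z u
    let ?X = "R x" and ?Y = "R y" and ?Z = "R z"
    show "induced_mult mult R (ind.anticommutator x y) (induced_mult mult R z u)
        + induced_mult mult R (ind.anticommutator y z) (induced_mult mult R x u)
        + induced_mult mult R (ind.anticommutator z x) (induced_mult mult R y u)
      = induced_mult mult R x (induced_mult mult R y (induced_mult mult R z u))
        + induced_mult mult R z (induced_mult mult R y (induced_mult mult R x u))
        + induced_mult mult R (ind.anticommutator (ind.anticommutator x z) y) u"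
      using jordan_identity_linearized[of ?Z u ?Y ?X]
      by (simp add: induced_mult_def R_circ ac_simps mult_commute)
    show "induced_mult mult R x (induced_mult mult R y (induced_mult mult R z u))
        + induced_mult mult R z (induced_mult mult R y (induced_mult mult R x u))
        + induced_mult mult R (ind.anticommutator (ind.anticommutator x z) y) u
      = induced_mult mult R z (induced_mult mult R (ind.anticommutator x y) u)
        + induced_mult mult R x (induced_mult mult R (ind.anticommutator y z) u)
        + induced_mult mult R y (induced_mult mult R (ind.anticommutator z x) u)"
      using jordan_identity_linearized[of ?Z u ?Y ?X] jordan_identity_linearized[of ?X ?Y u ?Z]
      by (simp add: induced_mult_def R_circ ac_simps mult_commute)
  qed
qed

interpretation char_matrix: complex_algebra "(*s)" "char_matrix_mult M" for M
  by unfold_locales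
    (simp_all add: char_matrix_mult_def vec_eq_iff sum_2 algebra_simps)

lemma pre_jordan_J22: "pre_jordan_algebra (*s) (char_matrix_mult J22)"
  and pre_jordan_J51: "pre_jordan_algebra (*s) (char_matrix_mult J51)"
  and pre_jordan_J61: "pre_jordan_algebra (*s) (char_matrix_mult J61)"
  by (unfold_locales;
      simp add: char_matrix_mult_def char_matrix.anticommutator_def J22_def J51_def J61_def
        e1_def e2_def axis_def vec_eq_iff forall_2 sum_2 algebra_simps)+

end

theory Submission imports Defs begin

text \<open>The Rota-Baxter identity determines most of the Jordan product, because it makes products of
  eigenvectors of \<open>R\<close> into eigenvectors.  If \<open>R x = a x\<close> and \<open>R y = b y\<close> with
  \<open>a + b \<noteq> 0\<close>, then \<open>x y\<close> is zero or an eigenvector with eigenvalue \<open>a b / (a + b)\<close>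
  (\<open>eigenvectors_mult\<close>), and a plane has room for two eigenvalues at most.  For invertible \<open>R\<close> this
  is the statement that the derivation \<open>R\<^sup>-\<^sup>1\<close> adds eigenvalues.

  If \<open>R\<close> is injective, repeated squaring of an eigenvector halves the eigenvalue, so it must reach
  zero and there is an eigenvector \<open>w\<close> with \<open>w w = 0\<close>.  In a basis \<open>w, u\<close> the same eigenvalue count
  gives \<open>w u = 0\<close> and \<open>u u = c w\<close>: the induced product is that of \<open>J51\<close> or zero
  (\<open>injective_case\<close>).

  If \<open>R\<close> has rank one, with kernel spanned by \<open>w\<close>, there are two possibilities.  When the image of
  \<open>R\<close> is not the kernel, it is spanned by an eigenvector \<open>u\<close> with \<open>u u = 0\<close> and \<open>u w = \<rho> w\<close>.  By
  the Jordan identity, multiplication by a square-zero element is nilpotent, so \<open>\<rho> = 0\<close> and the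
  induced product vanishes (\<open>non_nilpotent_rank_one_case\<close>).  When the image equals the kernel, the
  induced product of \<open>x\<close> and \<open>y\<close> is \<open>w y\<close> times a scalar depending on \<open>x\<close>.  The
  Rota-Baxter identity makes \<open>w\<close> an eigenvector of this multiplication, whose eigenvalue \<open>2 \<sigma>\<close> on
  \<open>w\<close> is twice its eigenvalue \<open>\<sigma>\<close> on the quotient by \<open>w\<close>.  For \<open>\<sigma> \<noteq> 0\<close> diagonalising it gives
  \<open>J22\<close>; for \<open>\<sigma> = 0\<close> one gets \<open>J51\<close> or zero (\<open>nilpotent_rank_one_case\<close>).\<close>

section \<open>Bases of a plane\<close>

text \<open>An ordered basis of the whole space, stated through coordinates because every later argument
  compares coefficients.\<close>

definition (in vector_space) basis_pair :: "'b \<Rightarrow> 'b \<Rightarrow> bool" where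
  "basis_pair p q \<longleftrightarrow> (\<forall>x. \<exists>a b. x = scale a p + scale b q) \<and>
     (\<forall>a b. scale a p + scale b q = 0 \<longrightarrow> a = 0 \<and> b = 0)"

context vector_space
begin

lemma basis_pair_commute: "basis_pair p q \<longleftrightarrow> basis_pair q p"
  unfolding basis_pair_def by (metis add.commute)

lemma basis_pair_coords:
  assumes "basis_pair p q"
  obtains a b where "x = scale a p + scale b q"
  using assms unfolding basis_pair_def by blast

lemma basis_pair_zero_iff:
  assumes "basis_pair p q"
  shows "scale a p + scale b q = 0 \<longleftrightarrow> a = 0 \<and> b = 0"
  using assms unfolding basis_pair_def by auto

lemma basis_pair_eq_iff:
  assumes "basis_pair p q"
  shows "scale a p + scale b q = scale c p + scale d q \<longleftrightarrow> a = c \<and> b = d"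
proof -
  have "scale a p + scale b q = scale c p + scale d q
      \<longleftrightarrow> scale (a - c) p + scale (b - d) q = 0"
    by (simp add: algebra_simps)
  thus ?thesis using basis_pair_zero_iff[OF assms, of "a - c" "b - d"] by simp
qed

lemma basis_pair_nonzero:
  assumes "basis_pair p q"
  shows "p \<noteq> 0" "q \<noteq> 0"
  using basis_pair_zero_iff[OF assms, of 1 0] basis_pair_zero_iff[OF assms, of 0 1] by auto

text \<open>Independent vectors, as many as the dimension, span a finite-dimensional space.  That the space
  is finite-dimensional follows from \<open>dim\<close> being nonzero, since infinite sets have \<open>card\<close> zero.\<close>

lemma basis_pairI:
  assumes dim2: "dim UNIV = 2" and p: "p \<noteq> 0" and q: "\<And>c. q \<noteq> scale c p"
  shows "basis_pair p q"
proof -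
  obtain B where B: "independent B" "span B = UNIV" "card B = 2"
    using dim2 basis_exists[of UNIV] by (metis UNIV_I subset_antisym subset_UNIV)
  have fB: "finite B"
    using B(3) by (metis card.infinite zero_neq_numeral)
  interpret fd: finite_dimensional_vector_space scale B
    by unfold_locales (use B fB in auto)
  have "q \<notin> span {p}"
    using q by (auto simp: span_singleton)
  moreover have "independent {p}" using p by simp
  ultimately have ind: "independent {q, p}"
    by (metis independent_insertI)
  have ne: "q \<noteq> p" using q[of 1] by auto
  have "UNIV \<subseteq> span {q, p}"
    using fd.card_ge_dim_independent[of "{q, p}" UNIV] ind ne dim2 by auto
  have "\<exists>a b. x = scale a p + scale b q" for x
  proof -
    obtain b where "x - scale b q \<in> span {p}"
      using \<open>UNIV \<subseteq> span {q, p}\<close> unfolding span_insert[of q "{p}"] by blast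
    then obtain a where "x - scale b q = scale a p"
      by (auto simp: span_singleton)
    thus ?thesis by (metis diff_add_cancel)
  qed
  moreover have "a = 0 \<and> b = 0" if *: "scale a p + scale b q = 0" for a b
  proof -
    have "b = 0"
    proof (rule ccontr)
      assume b: "b \<noteq> 0"
      have "scale b q = scale (- a) p"
        using * by (simp add: eq_neg_iff_add_eq_0 add.commute)
      hence "scale (inverse b) (scale b q) = scale (inverse b * - a) p"
        by simp
      hence "q = scale (inverse b * - a) p" using b by simp
      thus False using q by blast
    qed
    thus ?thesis using * p by simp
  qed
  ultimately show ?thesis unfolding basis_pair_def by blast
qed

lemma extend_to_basis_pair:
  assumes dim2: "dim UNIV = 2" and p: "p \<noteq> 0"
  obtains q where "basis_pair p q"
proof -
  have "\<exists>q. \<forall>c. q \<noteq> scale c p"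
  proof (rule ccontr)
    assume "\<not> ?thesis"
    hence "span {p} = UNIV" by (auto simp: span_singleton)
    hence "dim UNIV = 1"
      using p dim_eq_card[of "{p}" UNIV] by simp
    thus False using dim2 by simp
  qed
  thus ?thesis using basis_pairI[OF dim2 p] that by blast
qed

end

section \<open>Recognising the three products\<close>

text \<open>Both products are bilinear, so it suffices that the coordinate map carries products of basis
  vectors to products of basis vectors.\<close>

lemma (in pre_jordan_algebra) isomorphic_if_same_char_matrix:
  assumes M: "pre_jordan_algebra (*s) (char_matrix_mult M)"
    and pq: "basis_pair p q"
    and 11: "mult p p = scale (M $ 1 $ 1 $ 1) p + scale (M $ 1 $ 1 $ 2) q"
    and 12: "mult p q = scale (M $ 1 $ 2 $ 1) p + scale (M $ 1 $ 2 $ 2) q"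
    and 21: "mult q p = scale (M $ 2 $ 1 $ 1) p + scale (M $ 2 $ 1 $ 2) q"
    and 22: "mult q q = scale (M $ 2 $ 2 $ 1) p + scale (M $ 2 $ 2 $ 2) q"
  shows "pre_jordan_isomorphic scale mult (*s) (char_matrix_mult M)"
proof -
  interpret B: pre_jordan_algebra "(*s)" "char_matrix_mult M" by (rule M)
  \<comment> \<open>The inverse isomorphism is the one with an explicit formula.\<close>
  define g where "g v = scale (v $ 1) p + scale (v $ 2) q" for v :: "complex^2"
  have g_add: "g (v + w) = g v + g w" and g_scale: "g (c *s v) = scale c (g v)" for v w c
    by (simp_all add: g_def algebra_simps scale_left_distrib scale_right_distrib)
  have g_mult: "g (char_matrix_mult M v w) = mult (g v) (g w)" for v w
    by (simp add: g_def char_matrix_mult_def sum_2 add_left add_right scale_left scale_right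
        11 12 21 22 scale_left_distrib scale_right_distrib ac_simps)
  have "inj g"
    by (rule injI) (simp add: g_def basis_pair_eq_iff[OF pq] vec_eq_iff forall_2)
  moreover have "surj g"
    unfolding surj_def
  proof
    fix x
    obtain a b where "x = scale a p + scale b q" using basis_pair_coords[OF pq] .
    hence "x = g (vector [a, b])" by (simp add: g_def)
    thus "\<exists>v. x = g v" ..
  qed
  ultimately have bij: "bij g" by (rule bijI)
  define f where "f = inv g"
  have fg [simp]: "f (g v) = v" and gf [simp]: "g (f x) = x" for v x
    using bij unfolding f_def by (simp_all add: bij_is_inj bij_is_surj surj_f_inv_f)
  have "pre_jordan_isomorphism scale mult (*s) (char_matrix_mult M) f"
  proof unfold_locales
    show "f (x + y) = f x + f y" for x y by (metis fg gf g_add)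
    show "f (scale c x) = c *s f x" for c x by (metis fg gf g_scale)
    show "bij f" unfolding f_def by (rule bij_imp_bij_inv[OF bij])
    show "f (mult x y) = char_matrix_mult M (f x) (f y)" for x y by (metis fg gf g_mult)
  qed
  thus ?thesis unfolding pre_jordan_isomorphic_def by blast
qed

lemma (in pre_jordan_algebra) isomorphic_J22:
  assumes "basis_pair p q" "mult p p = p" "mult p q = scale 2 q" "mult q p = 0" "mult q q = 0"
  shows "pre_jordan_isomorphic scale mult (*s) (char_matrix_mult J22)"
  using assms
  by (intro isomorphic_if_same_char_matrix[OF pre_jordan_J22, of p q])
    (simp_all add: J22_def e1_def e2_def axis_def)

lemma (in pre_jordan_algebra) isomorphic_J51:
  assumes "basis_pair p q" "mult p p = q" "mult p q = 0" "mult q p = 0" "mult q q = 0"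
  shows "pre_jordan_isomorphic scale mult (*s) (char_matrix_mult J51)"
  using assms
  by (intro isomorphic_if_same_char_matrix[OF pre_jordan_J51, of p q])
    (simp_all add: J51_def e2_def axis_def)

lemma (in pre_jordan_algebra) isomorphic_J61:
  assumes "basis_pair p q" "mult p p = 0" "mult p q = 0" "mult q p = 0" "mult q q = 0"
  shows "pre_jordan_isomorphic scale mult (*s) (char_matrix_mult J61)"
  using assms
  by (intro isomorphic_if_same_char_matrix[OF pre_jordan_J61, of p q])
    (simp_all add: J61_def)

section \<open>Linear operators on a plane\<close>

lemma complex_quadratic_root:
  fixes b c :: complex
  obtains t where "t * t + b * t + c = 0"
proof -
  define d where "d = csqrt (b * b - 4 * c)"
  have d: "d * d = b * b - 4 * c"
    unfolding d_def by (metis power2_csqrt power2_eq_square)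
  have "((d - b) / 2) * ((d - b) / 2) + b * ((d - b) / 2) + c = (d * d - b * b) / 4 + c"
    by (simp add: field_simps)
  also have "\<dots> = 0" unfolding d by (simp add: field_simps)
  finally show ?thesis by (rule that)
qed

locale planar_operator = vector_space scale
  for scale :: "complex \<Rightarrow> 'a::ab_group_add \<Rightarrow> 'a" (infixr "\<star>" 75) +
  fixes R :: "'a \<Rightarrow> 'a"
  assumes linear_R: "Vector_Spaces.linear scale scale R"
    and dim2: "dim UNIV = 2"
begin

lemma R_add: "R (x + y) = R x + R y"
  and R_scale: "R (c \<star> x) = c \<star> R x"
proof -
  interpret R: Vector_Spaces.linear scale scale R by (rule linear_R)
  show "R (x + y) = R x + R y" "R (c \<star> x) = c \<star> R x"
    by (fact R.add R.scale)+
qed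

text \<open>In a basis \<open>p, q\<close> with \<open>R p = a p + b q\<close> and \<open>R q = c p + d q\<close>, either \<open>p\<close> is an
  eigenvector or some \<open>t p + b q\<close> is: comparing coefficients, its eigenvalue is \<open>t + d\<close>, and \<open>t\<close> has
  to solve a quadratic equation.\<close>

lemma eigenvector_exists:
  obtains w \<mu> where "w \<noteq> 0" "R w = \<mu> \<star> w"
proof -
  have "\<exists>w::'a. w \<noteq> 0"
  proof (rule ccontr)
    assume "\<not> ?thesis"
    hence "UNIV \<subseteq> span {}" by auto
    hence "dim UNIV \<le> card ({} :: 'a set)" by (intro dim_le_card) auto
    thus False using dim2 by simp
  qed
  then obtain p :: 'a where p: "p \<noteq> 0" by blast
  obtain q where pq: "basis_pair p q" by (rule extend_to_basis_pair[OF dim2 p])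
  obtain a b where Rp: "R p = a \<star> p + b \<star> q" by (rule basis_pair_coords[OF pq])
  obtain c d where Rq: "R q = c \<star> p + d \<star> q" by (rule basis_pair_coords[OF pq])
  show ?thesis
  proof (cases "b = 0")
    case True
    thus ?thesis using that p Rp by simp
  next
    case False
    obtain t where "t * t + (d - a) * t + - (b * c) = 0" by (rule complex_quadratic_root)
    hence t: "(t + d) * t = t * a + b * c" by (simp add: algebra_simps)
    have "R (t \<star> p + b \<star> q) = (t * a + b * c) \<star> p + ((t + d) * b) \<star> q"
      by (simp add: R_add R_scale Rp Rq scale_right_distrib scale_left_distrib algebra_simps)
    also have "\<dots> = (t + d) \<star> (t \<star> p + b \<star> q)"
      by (simp add: scale_right_distrib flip: t)
    finally show ?thesis
      using that False basis_pair_zero_iff[OF pq, of t b] by blast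
  qed
qed

text \<open>The eigenvalues of a triangular matrix are its diagonal entries, and an eigenvector with an
  eigenvalue different from the second entry \<open>\<nu>\<close> is a multiple of \<open>w\<close>.  This is how eigenvalues are counted
  below.\<close>

lemma triangular_eigenvector:
  assumes wu: "basis_pair w u" and Rw: "R w = \<mu> \<star> w" and Ru: "R u = \<kappa> \<star> w + \<nu> \<star> u"
    and Rx: "R x = c \<star> x" and x: "x \<noteq> 0"
  obtains "c = \<nu>" | a where "c = \<mu>" "x = a \<star> w"
proof -
  obtain a b where x_eq: "x = a \<star> w + b \<star> u" by (rule basis_pair_coords[OF wu])
  have "R x = (a * \<mu> + b * \<kappa>) \<star> w + (b * \<nu>) \<star> u"
    by (simp add: x_eq R_add R_scale Rw Ru scale_right_distrib scale_left_distrib algebra_simps)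
  moreover have "c \<star> x = (c * a) \<star> w + (c * b) \<star> u"
    by (simp add: x_eq scale_right_distrib)
  ultimately have eq: "a * \<mu> + b * \<kappa> = c * a" "b * \<nu> = c * b"
    using Rx basis_pair_eq_iff[OF wu] by metis+
  show ?thesis
  proof (cases "b = 0")
    case True
    hence "a \<noteq> 0" using x x_eq by auto
    thus ?thesis using True eq(1) x_eq that(2) by auto
  next
    case False
    thus ?thesis using eq(2) that(1) by simp
  qed
qed

end

section \<open>Rota-Baxter operators on a plane\<close>

locale planar_rota_baxter = rota_baxter_operator scale mult R + planar_operator scale R
  for scale :: "complex \<Rightarrow> 'a::ab_group_add \<Rightarrow> 'a" (infixr "\<star>" 75)
    and mult :: "'a \<Rightarrow> 'a \<Rightarrow> 'a" (infixl "\<otimes>" 70)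
    and R :: "'a \<Rightarrow> 'a"
begin

lemma mult_zero_left [simp]: "0 \<otimes> x = 0"
  and mult_zero_right [simp]: "x \<otimes> 0 = 0"
  using scale_left[of 0 0 x] scale_right[of x 0 0] by simp_all

interpretation induced: pre_jordan_algebra scale "induced_mult mult R"
  by (rule pre_jordan_induced_mult)

text \<open>On eigenvectors the Rota-Baxter identity reads \<open>a b (x y) = (a + b) R (x y)\<close>.\<close>

lemma eigenvectors_mult:
  assumes Rx: "R x = a \<star> x" and Ry: "R y = b \<star> y" and ab: "a + b \<noteq> 0"
  shows "R (x \<otimes> y) = (a * b / (a + b)) \<star> (x \<otimes> y)"
proof -
  have "(a * b) \<star> (x \<otimes> y) = (a + b) \<star> R (x \<otimes> y)"
    using rota_baxter[of x y]
    by (simp add: Rx Ry scale_left scale_right R_add R_scale scale_left_distrib mult.commute)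
  hence "(1 / (a + b)) \<star> ((a * b) \<star> (x \<otimes> y)) = (1 / (a + b)) \<star> ((a + b) \<star> R (x \<otimes> y))"
    by simp
  thus ?thesis using ab by simp
qed

lemma eigenvector_square:
  assumes "R x = a \<star> x" "a \<noteq> 0"
  shows "R (x \<otimes> x) = (a / 2) \<star> (x \<otimes> x)"
  using eigenvectors_mult[OF assms(1) assms(1)] assms(2) by simp

text \<open>Linearising the Jordan identity in its repeated variable and setting all arguments but one
  equal to \<open>v\<close> leaves only two terms without the factor \<open>v v\<close>, and these coincide.\<close>

lemma square_zero_imp_nilpotent:
  assumes vv: "v \<otimes> v = 0"
  shows "v \<otimes> (v \<otimes> (v \<otimes> x)) = 0"
proof -
  have "2 \<star> (v \<otimes> (v \<otimes> (v \<otimes> x))) = 0"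
    using jordan_identity_linearized[of v v v x] scale_left_distrib[of 1 1 "v \<otimes> (v \<otimes> (v \<otimes> x))"]
    by (simp add: vv mult_commute[of x v] mult_commute[of "_ \<otimes> _" v])
  thus ?thesis by simp
qed

text \<open>If \<open>w\<close> has eigenvalue \<open>\<mu>\<close>, then \<open>w w\<close> and its square have eigenvalues \<open>\<mu> / 2\<close> and \<open>\<mu> / 4\<close> unless
  they vanish.  Three different eigenvalues do not fit into a plane, so \<open>w\<close> or \<open>w w\<close> will do.\<close>

lemma square_zero_eigenvector_exists:
  assumes inj: "\<And>x. R x = 0 \<Longrightarrow> x = 0"
  obtains w \<mu> where "w \<noteq> 0" "\<mu> \<noteq> 0" "R w = \<mu> \<star> w" "w \<otimes> w = 0"
proof -
  obtain w \<mu> where w: "w \<noteq> 0" "R w = \<mu> \<star> w" by (rule eigenvector_exists)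
  have \<mu>: "\<mu> \<noteq> 0" using w inj by auto
  define s where "s = w \<otimes> w"
  show ?thesis
  proof (cases "s = 0")
    case True
    thus ?thesis using that[OF w(1) \<mu> w(2)] by (simp add: s_def)
  next
    case False
    have Rs: "R s = (\<mu> / 2) \<star> s"
      unfolding s_def by (rule eigenvector_square[OF w(2) \<mu>])
    have Rss: "R (s \<otimes> s) = (\<mu> / 4) \<star> (s \<otimes> s)"
      using eigenvector_square[OF Rs] \<mu> by simp
    obtain u where wu: "basis_pair w u" by (rule extend_to_basis_pair[OF dim2 w(1)])
    obtain \<kappa> \<nu> where Ru: "R u = \<kappa> \<star> w + \<nu> \<star> u" by (rule basis_pair_coords[OF wu])
    have \<nu>: "\<nu> = \<mu> / 2"
      by (rule triangular_eigenvector[OF wu w(2) Ru Rs False]) (use \<mu> in auto)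
    have "s \<otimes> s = 0"
    proof (rule ccontr)
      assume "s \<otimes> s \<noteq> 0"
      thus False
        by (rule triangular_eigenvector[OF wu w(2) Ru Rss]) (use \<mu> \<nu> in auto)
    qed
    thus ?thesis using that[OF False _ Rs] \<mu> by simp
  qed
qed

text \<open>The common ending of the cases with a nilpotent induced product: rescaling \<open>w\<close> turns a nonzero
  coefficient \<open>c\<close> into \<open>1\<close>.\<close>

lemma isomorphic_J51_or_J61:
  assumes wu: "basis_pair w u" and uu: "R u \<otimes> u = c \<star> w"
    and "R u \<otimes> w = 0" "R w \<otimes> u = 0" "R w \<otimes> w = 0"
  shows "pre_jordan_isomorphic scale (induced_mult mult R) (*s) (char_matrix_mult J51)
       \<or> pre_jordan_isomorphic scale (induced_mult mult R) (*s) (char_matrix_mult J61)"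
proof (cases "c = 0")
  case True
  thus ?thesis using assms
    by (intro disjI2 induced.isomorphic_J61[OF wu]) (simp_all add: induced_mult_def)
next
  case False
  have "basis_pair (c \<star> w) u"
  proof (rule basis_pairI[OF dim2])
    show "c \<star> w \<noteq> 0" using False basis_pair_nonzero[OF wu] by simp
    show "u \<noteq> d \<star> c \<star> w" for d
      using basis_pair_eq_iff[OF wu, of 0 1 "d * c" 0] by auto
  qed
  hence "basis_pair u (c \<star> w)" by (simp add: basis_pair_commute)
  thus ?thesis using assms
    by (intro disjI1 induced.isomorphic_J51[of u "c \<star> w"])
      (simp_all add: induced_mult_def scale_right scale_left R_scale)
qed

text \<open>Take \<open>w\<close> an eigenvector with \<open>w w = 0\<close> and eigenvalue \<open>\<mu>\<close>, and let \<open>\<nu>\<close> be the other eigenvalue of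
  \<open>R\<close>.  Since \<open>\<mu> \<nu> / (\<mu> + \<nu>)\<close> is neither \<open>\<mu>\<close> nor \<open>\<nu>\<close>, the product \<open>w u\<close> vanishes; since
  \<open>\<nu> / 2 \<noteq> \<nu>\<close>, the square \<open>u u\<close> lies on the line of \<open>w\<close>.  The vector \<open>u\<close> itself need not be an
  eigenvector, as \<open>R\<close> need not be diagonalisable, but what \<open>R u\<close> contributes along \<open>w\<close> multiplies to
  zero.\<close>

lemma injective_case:
  assumes inj: "\<And>x. R x = 0 \<Longrightarrow> x = 0"
  shows "pre_jordan_isomorphic scale (induced_mult mult R) (*s) (char_matrix_mult J51)
       \<or> pre_jordan_isomorphic scale (induced_mult mult R) (*s) (char_matrix_mult J61)"
proof -
  obtain w \<mu> where w: "w \<noteq> 0" "\<mu> \<noteq> 0" "R w = \<mu> \<star> w" and ww: "w \<otimes> w = 0"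
    by (rule square_zero_eigenvector_exists[OF inj])
  obtain u where wu: "basis_pair w u" by (rule extend_to_basis_pair[OF dim2 w(1)])
  obtain \<kappa> \<nu> where Ru: "R u = \<kappa> \<star> w + \<nu> \<star> u" by (rule basis_pair_coords[OF wu])
  note eigenvector = triangular_eigenvector[OF wu w(3) Ru]
  have \<nu>: "\<nu> \<noteq> 0"
  proof
    \<comment> \<open>Otherwise \<open>R u\<close> and \<open>R w\<close> are proportional, which gives a vector in the kernel.\<close>
    assume "\<nu> = 0"
    hence "R (\<mu> \<star> u + - \<kappa> \<star> w) = 0"
      by (simp only: R_add R_scale Ru w(3) scale_right_distrib scale_scale) (simp add: mult.commute)
    hence "\<mu> \<star> u + - \<kappa> \<star> w = 0" by (rule inj)
    hence "- \<kappa> \<star> w + \<mu> \<star> u = 0" by (simp only: add.commute)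
    thus False using basis_pair_zero_iff[OF wu, of "- \<kappa>" \<mu>] w(2) by blast
  qed
  have Rwu: "(\<mu> * \<nu>) \<star> (w \<otimes> u) = (\<mu> + \<nu>) \<star> R (w \<otimes> u)"
    using rota_baxter[of w u]
    by (simp add: w(3) Ru scale_left scale_right add_right ww R_add R_scale scale_left_distrib
        mult.commute)
  have wu0: "w \<otimes> u = 0"
  proof (rule ccontr)
    assume ne: "w \<otimes> u \<noteq> 0"
    hence sum: "\<mu> + \<nu> \<noteq> 0" using Rwu w(2) \<nu> by auto
    have "(1 / (\<mu> + \<nu>)) \<star> ((\<mu> * \<nu>) \<star> (w \<otimes> u)) = (1 / (\<mu> + \<nu>)) \<star> ((\<mu> + \<nu>) \<star> R (w \<otimes> u))"
      by (simp only: Rwu)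
    hence "R (w \<otimes> u) = (\<mu> * \<nu> / (\<mu> + \<nu>)) \<star> (w \<otimes> u)" using sum by simp
    thus False
      by (rule eigenvector[OF _ ne]) (use sum w(2) \<nu> in \<open>auto simp: field_simps\<close>)
  qed
  have Ru_mult: "R u \<otimes> y = \<kappa> \<star> (w \<otimes> y) + \<nu> \<star> (u \<otimes> y)" for y
    by (simp add: Ru add_left scale_left)
  have "\<nu> \<star> (\<nu> \<star> (u \<otimes> u)) = \<nu> \<star> (2 \<star> R (u \<otimes> u))"
    using rota_baxter[of u u] scale_left_distrib[of 1 1 "R (u \<otimes> u)"]
    by (simp add: Ru add_left add_right scale_left scale_right ww wu0 mult_commute[of u w]
        R_add R_scale scale_right_distrib)
  hence "\<nu> \<star> (u \<otimes> u) = 2 \<star> R (u \<otimes> u)" by (rule scale_left_imp_eq[OF \<nu>])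
  hence "(1 / 2) \<star> (\<nu> \<star> (u \<otimes> u)) = (1 / 2) \<star> (2 \<star> R (u \<otimes> u))" by simp
  hence Ruu: "R (u \<otimes> u) = (\<nu> / 2) \<star> (u \<otimes> u)" by simp
  obtain c where "u \<otimes> u = c \<star> w"
  proof (cases "u \<otimes> u = 0")
    case True
    thus ?thesis using that[of 0] by simp
  next
    case False
    thus ?thesis by (rule eigenvector[OF Ruu]) (use \<nu> that in auto)
  qed
  hence "R u \<otimes> u = (\<nu> * c) \<star> w" by (simp add: Ru_mult wu0)
  thus ?thesis
    by (rule isomorphic_J51_or_J61[OF wu])
      (simp_all add: Ru_mult w(3) ww wu0 mult_commute[of u w] scale_left)
qed

text \<open>The product \<open>u w\<close> of eigenvectors has eigenvalue \<open>0\<close>, so \<open>w\<close> is an eigenvector of multiplication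
  by \<open>u\<close>, and \<open>u u = 0\<close> because \<open>\<nu> / 2\<close> is not an eigenvalue of \<open>R\<close>.  Multiplication by the
  square-zero element \<open>u\<close> is nilpotent, so its eigenvalue \<open>\<rho>\<close> on \<open>w\<close> is zero.\<close>

lemma non_nilpotent_rank_one_case:
  assumes w: "w \<noteq> 0" "R w = 0" and wu: "basis_pair w u" and Ru: "R u = \<nu> \<star> u" and \<nu>: "\<nu> \<noteq> 0"
  shows "pre_jordan_isomorphic scale (induced_mult mult R) (*s) (char_matrix_mult J61)"
proof -
  have ker: "\<exists>c. x = c \<star> w" if "R x = 0" for x
  proof -
    obtain a b where x: "x = a \<star> w + b \<star> u" by (rule basis_pair_coords[OF wu])
    have "b = 0"
      using that \<nu> basis_pair_nonzero[OF wu] by (simp add: x R_add R_scale w(2) Ru)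
    thus ?thesis using x by auto
  qed
  have Rw: "R w = 0 \<star> w" and Ru': "R u = 0 \<star> w + \<nu> \<star> u" using w(2) Ru by simp_all
  have uu: "u \<otimes> u = 0"
  proof (rule ccontr)
    have Ruu: "R (u \<otimes> u) = (\<nu> / 2) \<star> (u \<otimes> u)" by (rule eigenvector_square[OF Ru \<nu>])
    assume "u \<otimes> u \<noteq> 0"
    thus False
      by (rule triangular_eigenvector[OF wu Rw Ru' Ruu]) (use \<nu> in auto)
  qed
  have "R (u \<otimes> w) = 0"
    using eigenvectors_mult[of u \<nu> w 0] Ru w(2) \<nu> by simp
  then obtain \<rho> where uw: "u \<otimes> w = \<rho> \<star> w" using ker by blast
  have "\<rho> = 0"
    using square_zero_imp_nilpotent[OF uu, of w] w(1) by (simp add: uw scale_right)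
  thus ?thesis
    by (intro induced.isomorphic_J61[OF wu])
      (simp_all add: induced_mult_def w(2) Ru uw uu scale_left)
qed

text \<open>Everything is determined by multiplication by \<open>w\<close>.  With \<open>w u = \<tau> w + \<sigma> u\<close>, the Rota-Baxter
  identity for \<open>u, u\<close> forces \<open>w w = 2 \<sigma> w\<close>.  If \<open>\<sigma> \<noteq> 0\<close> then \<open>w / (2 \<sigma>)\<close> is an idempotent with
  eigenvalues \<open>1\<close> and \<open>1 / 2\<close>, and this ratio is the coefficient \<open>2\<close> in \<open>J22\<close>.\<close>

lemma nilpotent_rank_one_case:
  assumes wu: "basis_pair w u" and Rw: "R w = 0" and Ru: "R u = \<kappa> \<star> w" and \<kappa>: "\<kappa> \<noteq> 0"
  shows "pre_jordan_isomorphic scale (induced_mult mult R) (*s) (char_matrix_mult J22)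
       \<or> pre_jordan_isomorphic scale (induced_mult mult R) (*s) (char_matrix_mult J51)
       \<or> pre_jordan_isomorphic scale (induced_mult mult R) (*s) (char_matrix_mult J61)"
proof -
  note w = basis_pair_nonzero(1)[OF wu]
  obtain \<tau> \<sigma> where w_u: "w \<otimes> u = \<tau> \<star> w + \<sigma> \<star> u" by (rule basis_pair_coords[OF wu])
  have "(\<kappa> * \<kappa>) \<star> (w \<otimes> w) = (\<kappa> * \<kappa>) \<star> ((2 * \<sigma>) \<star> w)"
    using rota_baxter[of u u]
    by (simp add: Ru Rw w_u scale_left scale_right mult_commute[of u w] R_add R_scale
        mult.left_commute flip: scale_left_distrib)
  hence ww: "w \<otimes> w = (2 * \<sigma>) \<star> w" 
    by (rule scale_left_imp_eq[rotated]) (use \<kappa> in simp)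
  show ?thesis
  proof (cases "\<sigma> = 0")
    case True
    thus ?thesis
      using isomorphic_J51_or_J61[OF wu, of "\<kappa> * \<tau>"] by (simp add: Ru Rw scale_left w_u ww)
  next
    case False
    \<comment> \<open>The vector \<open>p = \<beta> w + \<alpha> u\<close> is to be the \<open>\<sigma>\<close>-eigenvector of multiplication by \<open>w\<close>, which fixes
      the ratio \<open>\<beta> : \<alpha>\<close>; requiring \<open>R p = (1 / \<sigma>) w\<close> then fixes the scale.\<close>
    define \<alpha> \<beta> where "\<alpha> = 1 / (\<kappa> * \<sigma>)" and "\<beta> = - \<tau> / (\<kappa> * \<sigma> * \<sigma>)"
    have \<alpha>: "\<alpha> \<noteq> 0" "\<alpha> * \<kappa> = 1 / \<sigma>"
      and \<beta>: "1 / \<sigma> * (\<alpha> * \<tau>) + 1 / \<sigma> * (\<beta> * (2 * \<sigma>)) = \<beta>"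
    proof -
      show "\<alpha> \<noteq> 0" "\<alpha> * \<kappa> = 1 / \<sigma>" using \<kappa> False by (simp_all add: \<alpha>_def)
      have "1 / \<sigma> * (\<alpha> * \<tau>) = - \<beta>" by (simp add: \<alpha>_def \<beta>_def)
      moreover have "1 / \<sigma> * (\<beta> * (2 * \<sigma>)) = 2 * \<beta>" using False by simp
      ultimately show "1 / \<sigma> * (\<alpha> * \<tau>) + 1 / \<sigma> * (\<beta> * (2 * \<sigma>)) = \<beta>" by simp
    qed
    define p where "p = \<beta> \<star> w + \<alpha> \<star> u"
    have "basis_pair w p"
    proof (rule basis_pairI[OF dim2 w])
      show "p \<noteq> c \<star> w" for c
        using basis_pair_eq_iff[OF wu, of \<beta> \<alpha> c 0] \<alpha>(1) by (simp add: p_def)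
    qed
    hence pw: "basis_pair p w" by (simp add: basis_pair_commute)
    have Rp: "R p = (1 / \<sigma>) \<star> w"
      by (simp add: p_def R_add R_scale Ru Rw \<alpha>(2))
    have "w \<otimes> p = (\<alpha> * \<tau> + \<beta> * (2 * \<sigma>)) \<star> w + (\<alpha> * \<sigma>) \<star> u"
      by (simp add: p_def add_right scale_right w_u ww scale_right_distrib scale_left_distrib)
    hence "R p \<otimes> p = (1 / \<sigma> * (\<alpha> * \<tau> + \<beta> * (2 * \<sigma>))) \<star> w + (1 / \<sigma> * (\<alpha> * \<sigma>)) \<star> u"
      by (simp only: Rp scale_left scale_right_distrib scale_scale)
    also have "\<dots> = p"
      unfolding p_def distrib_left \<beta> using False by simp
    finally have "R p \<otimes> p = p" .
    thus ?thesis using False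
      by (intro disjI1 induced.isomorphic_J22[OF pw])
        (simp_all add: induced_mult_def Rw Rp scale_left ww)
  qed
qed

text \<open>A non-injective \<open>R\<close> has triangular form with first diagonal entry \<open>0\<close>; the second entry \<open>\<nu>\<close> tells
  whether \<open>R\<close> is nilpotent.\<close>

theorem induced_mult_classification:
  "pre_jordan_isomorphic scale (induced_mult mult R) (*s) (char_matrix_mult J22)
 \<or> pre_jordan_isomorphic scale (induced_mult mult R) (*s) (char_matrix_mult J51)
 \<or> pre_jordan_isomorphic scale (induced_mult mult R) (*s) (char_matrix_mult J61)"
proof (cases "\<forall>x. R x = 0 \<longrightarrow> x = 0")
  case True
  thus ?thesis using injective_case by blast
next
  case False
  then obtain w where w: "w \<noteq> 0" "R w = 0" by blast
  obtain u where wu: "basis_pair w u" by (rule extend_to_basis_pair[OF dim2 w(1)])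
  obtain \<kappa> \<nu> where Ru: "R u = \<kappa> \<star> w + \<nu> \<star> u" by (rule basis_pair_coords[OF wu])
  show ?thesis
  proof (cases "\<nu> = 0")
    case True
    hence Ru': "R u = \<kappa> \<star> w" using Ru by simp
    show ?thesis
    proof (cases "\<kappa> = 0")
      case True
      thus ?thesis using w(2) Ru'
        by (intro disjI2 induced.isomorphic_J61[OF wu]) (simp_all add: induced_mult_def)
    next
      case False
      thus ?thesis by (rule nilpotent_rank_one_case[OF wu w(2) Ru'])
    qed
  next
    case False
    \<comment> \<open>The image of \<open>R\<close> is spanned by \<open>R u\<close>, which is an eigenvector off the kernel.\<close>
    have "basis_pair w (R u)"
      by (rule basis_pairI[OF dim2 w(1)])
        (use False basis_pair_eq_iff[OF wu, of \<kappa> \<nu> _ 0] in \<open>auto simp: Ru\<close>)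
    moreover have "R (R u) = \<nu> \<star> R u"
      using arg_cong[OF Ru, of R] by (simp add: R_add R_scale w(2))
    ultimately show ?thesis
      using non_nilpotent_rank_one_case[OF w] False by blast
  qed
qed

end

theorem theorem5p11:
  fixes scale :: "complex \<Rightarrow> 'a::ab_group_add \<Rightarrow> 'a"
    and circ :: "'a \<Rightarrow> 'a \<Rightarrow> 'a"
    and R :: "'a \<Rightarrow> 'a"
  assumes "jordan_algebra scale circ"
    and "vector_space.dim scale (UNIV :: 'a set) = 2"
    and "rota_baxter_operator scale circ R"
  shows "pre_jordan_isomorphic scale (induced_mult circ R) (*s) (char_matrix_mult J22)
       \<or> pre_jordan_isomorphic scale (induced_mult circ R) (*s) (char_matrix_mult J51)
       \<or> pre_jordan_isomorphic scale (induced_mult circ R) (*s) (char_matrix_mult J61)"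
proof (rule planar_rota_baxter.induced_mult_classification)
  interpret rota_baxter_operator scale circ R by (rule assms(3))
  have "planar_operator scale R"
    by (intro planar_operator.intro planar_operator_axioms.intro vector_space_axioms linear_R
        assms(2))
  thus "planar_rota_baxter scale circ R"
    by (rule planar_rota_baxter.intro[OF assms(3)])
qed

end
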